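(* Let $d\ge 1$ be an integer. There exist an isometry invariant $\sigma$-algebra $\mathcal{A}$ of subsets of $\mathbb{R}^d$ containing all Borel subsets of $\mathbb{R}^d$, and an isometry invariant $\sigma$-finite measure $\mu$ defined on $\mathcal{A}$, such that for every Borel set $B\subset\mathbb{R}^d$: if $\lambda_d(B)=0$ then $\mu(B)=0$, while if $\lambda_d(B)>0$ then $\mu(B)=\infty$.
   Context: $\lambda_d$ denotes $d$-dimensional Lebesgue measure. $\mathrm{Isom}(\mathbb{R}^d)$ is the group of isometries of $\mathbb{R}^d$. A $\sigma$-algebra $\mathcal{A}$ of subsets of $\mathbb{R}^d$ is isometry invariant if $\varphi(A)\in\mathcal{A}$ for every $A\in\mathcal{A}$ and every $\varphi\in\mathrm{Isom}(\mathbb{R}^d)$. A measure $\mu$ on such an $\mathcal{A}$ is isometry invariant if $\mu(\varphi(A))=\mu(A)$ for every $A\in\mathcal{A}$ and every $\varphi\in\mathrm{Isom}(\mathbb{R}^d)$. The measure $\mu$ is $\sigma$-finite if $\mathbb{R}^d$ is a countable union of members of $\mathcal{A}$ (not necessarily Borel sets) of finite $\mu$-measure. Measures take values in $[0,\infty]$. *)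

theory Defs
  imports "HOL-Analysis.Analysis"
begin

definition isometries :: "('a::metric_space \<Rightarrow> 'a) set" where
  "isometries = {\<phi>. bij \<phi> \<and> (\<forall>x y. dist (\<phi> x) (\<phi> y) = dist x y)}"

definition isometry_invariant_sets :: "'a::metric_space set set \<Rightarrow> bool" where
  "isometry_invariant_sets \<A> \<longleftrightarrow> (\<forall>A\<in>\<A>. \<forall>\<phi>\<in>isometries. \<phi> ` A \<in> \<A>)"

(* emeasure is 0 outside sets M, so this is meant for M with isometry_invariant_sets (sets M). *)
definition isometry_invariant_measure :: "'a::metric_space measure \<Rightarrow> bool" where
  "isometry_invariant_measure M \<longleftrightarrow>
     (\<forall>A\<in>sets M. \<forall>\<phi>\<in>isometries. emeasure M (\<phi> ` A) = emeasure M A)"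

end

(* Call a set small if it has fewer than continuum many points. Transfinite recursion of length
   continuum yields disjoint sets A_0, A_1, ... such that every A_n meets every closed set of positive
   Lebesgue measure in continuum many points, while A_n differs from each of its isometric images by a
   small set: at stage i one adds to some A_n the orbit of a new point under the group generated by the
   isometries listed up to stage i, so an isometry listed at stage c can only move the orbits added
   before stage c. Let a set E belong to the sigma-algebra if for every n its trace on A_n agrees with
   that of a Borel set B_n up to a small set, and put mu(E) = sum of lambda(B_n). Thickness of A_n
   makes lambda(B_n) well defined. A Borel set B has B_n = B for all n, so mu(B) is 0 or infinite,
   whereas the intersection of A_n with a ball has the finite measure of the ball. *)
theory Submission
  imports Defs
begin

section \<open>Sets of size less than the continuum\<close>

text \<open>The power set of \<open>nat\<close> stands for the continuum. As any two sets are
  comparable in size, failure of an injection amounts to strictly smaller cardinality.\<close>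

definition small :: "'a set \<Rightarrow> bool" where
  "small X \<longleftrightarrow> \<not> (UNIV :: nat set set) \<lesssim> X"

lemma small_lepoll: "small Y \<Longrightarrow> X \<lesssim> Y \<Longrightarrow> small X"
  unfolding small_def using lepoll_trans by blast

lemma small_subset: "small Y \<Longrightarrow> X \<subseteq> Y \<Longrightarrow> small X"
  using small_lepoll subset_imp_lepoll by blast

lemma small_image: "small X \<Longrightarrow> small (f ` X)"
  by (rule small_lepoll[OF _ image_lepoll])

lemma countable_imp_small: "countable X \<Longrightarrow> small X"
proof -
  assume "countable X"
  then have "X \<lesssim> (UNIV :: nat set)"
    unfolding countable_def lepoll_def by blast
  moreover have "\<not> (UNIV :: nat set set) \<lesssim> (UNIV :: nat set)"
    using Cantors_theorem[of "UNIV :: nat set"] by (force simp: lepoll_iff)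
  ultimately show "small X"
    unfolding small_def using lepoll_trans by blast
qed

text \<open>The pairing bijection lets one subset of \<open>nat\<close> code a sequence of such
  subsets; this serves both the diagonal argument and the bookkeeping of the recursion.\<close>

definition slice :: "nat set \<Rightarrow> nat \<Rightarrow> nat set" where
  "slice X k = {m. prod_encode (k, m) \<in> X}"

lemma surj_slice: "surj slice"
proof (rule surjI)
  fix f :: "nat \<Rightarrow> nat set"
  show "slice {n. snd (prod_decode n) \<in> f (fst (prod_decode n))} = f"
    by (auto simp: slice_def fun_eq_iff)
qed

text \<open>The diagonal argument of Koenig's theorem, so that no regularity of the continuum is needed.\<close>

lemma small_UN_nat:
  fixes X :: "nat \<Rightarrow> 'a set"
  assumes X: "\<And>n. small (X n)"
  shows "small (\<Union>n. X n)"
  unfolding small_def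
proof
  assume "(UNIV :: nat set set) \<lesssim> (\<Union>n. X n)"
  then obtain h where h: "(UNIV :: nat set set) \<subseteq> h ` (\<Union>n. X n)"
    unfolding lepoll_iff by blast
  \<comment> \<open>Otherwise column \<open>n\<close> of \<open>h\<close> would map the small set
    \<open>X n\<close> onto \<open>nat set\<close>. A set \<open>W\<close> whose columns are these
    omitted values then escapes \<open>h\<close> altogether.\<close>
  have "\<exists>Z. Z \<notin> (\<lambda>x. slice (h x) n) ` X n" for n
    using X[of n] unfolding small_def lepoll_iff by blast
  then obtain Z where Z: "\<And>n. Z n \<notin> (\<lambda>x. slice (h x) n) ` X n"
    by metis
  obtain W where "slice W = Z"
    using surj_slice by (metis surjE)
  moreover obtain n x where "x \<in> X n" "W = h x"
    using h by blast
  ultimately show False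
    using Z[of n] by blast
qed

lemma small_Un: "small X \<Longrightarrow> small Y \<Longrightarrow> small (X \<union> Y)"
  using small_UN_nat[of "\<lambda>n. if n = 0 then X else Y"]
  by (rule small_subset) (auto split: if_splits)

lemma lepoll_linear: "X \<lesssim> Y \<or> Y \<lesssim> X"
  using ordLeq_total[of "card_of X" "card_of Y"]
  unfolding lepoll_def card_of_ordLeq[symmetric]
  by (simp add: card_of_Well_order)

lemma small_Times_self: "small Z \<Longrightarrow> small (Z \<times> Z)"
proof (cases "finite Z")
  case False
  assume "small Z"
  have "Z \<times> Z \<approx> Z"
    unfolding eqpoll_iff_card_of_ordIso
    using card_of_Times_same_infinite[OF False] .
  with \<open>small Z\<close> show ?thesis
    using eqpoll_imp_lepoll small_lepoll by blast
qed (simp add: countable_imp_small countable_finite)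

lemma small_Times:
  assumes "small X" "small Y"
  shows "small (X \<times> Y)"
  using lepoll_linear[of X Y]
proof
  assume "X \<lesssim> Y"
  then have "X \<times> Y \<lesssim> Y \<times> Y"
    by (intro times_lepoll_mono) auto
  with assms show ?thesis using small_Times_self small_lepoll by blast
next
  assume "Y \<lesssim> X"
  then have "X \<times> Y \<lesssim> X \<times> X"
    by (intro times_lepoll_mono) auto
  with assms show ?thesis using small_Times_self small_lepoll by blast
qed

text \<open>The strict part of a cardinal order on \<open>nat set\<close>: minimality of the order
  type makes proper initial segments small, so every stage of the recursion has few
  predecessors.\<close>

lemma small_wellorder:
  obtains R :: "(nat set \<times> nat set) set"
  where "wf R" "trans R" "\<And>a b. a \<noteq> b \<Longrightarrow> (a, b) \<in> R \<or> (b, a) \<in> R"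
    "\<And>a. small {b. (b, a) \<in> R}"
proof
  define r where "r = card_of (UNIV :: nat set set)"
  have c: "card_order_on UNIV r"
    unfolding r_def by (rule card_of_card_order_on)
  have F: "Field r = UNIV"
    by (simp add: r_def Field_card_of)
  have wo: "Well_order r"
    by (simp add: r_def card_of_Well_order)
  then have lin: "Linear_order r" and wf: "wf (r - Id)"
    by (auto simp: well_order_on_def)
  then have "trans r" "antisym r" "total_on UNIV r"
    by (auto simp: linear_order_on_def partial_order_on_def preorder_on_def F)
  then show "wf (r - Id)" "trans (r - Id)"
    "\<And>a b. a \<noteq> b \<Longrightarrow> (a, b) \<in> r - Id \<or> (b, a) \<in> r - Id"
    using wf by (auto simp: trans_diff_Id total_on_def)
  fix a
  have "{b. (b, a) \<in> r - Id} = underS r a"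
    by (auto simp: underS_def)
  moreover have "(card_of (underS r a), r) \<in> ordLess"
    by (rule card_of_underS) (simp_all add: F c)
  then have "(r, card_of (underS r a)) \<notin> ordLeq"
    using not_ordLess_ordLeq by blast
  ultimately show "small {b. (b, a) \<in> r - Id}"
    unfolding small_def lepoll_def r_def card_of_ordLeq by simp
qed

section \<open>Almost invariant families\<close>

text \<open>For a set \<open>G\<close> of bijections closed under inverses, this is the union of the
  orbits of points of \<open>X\<close> under the group generated by \<open>G\<close>.\<close>

definition orbit :: "('a \<Rightarrow> 'a) set \<Rightarrow> 'a set \<Rightarrow> 'a set" where
  "orbit G X = {(x, g x) |x g. g \<in> G}\<^sup>* `` X"

lemma orbit_superset: "X \<subseteq> orbit G X"
  by (auto simp: orbit_def)

lemma orbit_mono: "G \<subseteq> H \<Longrightarrow> X \<subseteq> Y \<Longrightarrow> orbit G X \<subseteq> orbit H Y"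
  unfolding orbit_def by (intro Image_mono rtrancl_mono) auto

lemma orbit_closed: "g \<in> G \<Longrightarrow> x \<in> orbit G X \<Longrightarrow> g x \<in> orbit G X"
  unfolding orbit_def by (auto intro: rtrancl.rtrancl_into_rtrancl)

lemma orbit_trans: "X \<subseteq> orbit G Y \<Longrightarrow> orbit G X \<subseteq> orbit G Y"
  unfolding orbit_def Image_def subset_iff by (blast intro: rtrancl_trans)

lemma orbit_sym:
  assumes "\<And>g. g \<in> G \<Longrightarrow> bij g" "\<And>g. g \<in> G \<Longrightarrow> inv g \<in> G"
    and "y \<in> orbit G {x}"
  shows "x \<in> orbit G {y}"
proof -
  have "sym {(x, g x) |x g. g \<in> G}"
  proof (rule symI)
    fix a b assume "(a, b) \<in> {(x, g x) |x g. g \<in> G}"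
    then obtain g where "g \<in> G" "b = g a" by blast
    then have "a = inv g b" "inv g \<in> G"
      using assms(1,2) by (auto simp: bij_is_inj)
    then show "(b, a) \<in> {(x, g x) |x g. g \<in> G}" by blast
  qed
  then have "sym ({(x, g x) |x g. g \<in> G}\<^sup>*)"
    by (rule sym_rtrancl)
  then show ?thesis
    using assms(3) unfolding orbit_def by (auto dest: symD)
qed

text \<open>The orbit is the countable union of the sets reached in exactly \<open>n\<close> steps,
  and one step is covered by an image of a product of two small sets.\<close>

lemma small_orbit:
  assumes G: "small G" and X: "small X"
  shows "small (orbit G X)"
proof -
  let ?R = "{(x, g x) |x g. g \<in> G}"
  have step: "small (?R `` Y)" if "small Y" for Y
  proof (rule small_subset)
    show "small ((\<lambda>(g, x). g x) ` (G \<times> Y))"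
      using G that by (intro small_image small_Times)
  qed auto
  have "small ((?R ^^ n) `` X)" for n
  proof (induction n)
    case (Suc n)
    have "(?R ^^ Suc n) `` X = ?R `` ((?R ^^ n) `` X)"
      by (simp only: relpow.simps relcomp_Image)
    then show ?case using step[OF Suc] by (simp only:)
  qed (simp add: X)
  then have "small (\<Union>n. (?R ^^ n) `` X)"
    by (rule small_UN_nat)
  moreover have "orbit G X = (\<Union>n. (?R ^^ n) `` X)"
    unfolding orbit_def rtrancl_is_UN_relpow by (rule UN_Image)
  ultimately show ?thesis by (simp only:)
qed

text \<open>Supplies enumerations, with repetitions, indexed by \<open>nat set\<close>; values of
  the covering map outside \<open>C\<close> are redirected to a fixed \<open>c\<close>.\<close>

lemma lepoll_imp_range:
  fixes C :: "'a set"
  assumes "C \<lesssim> (UNIV :: 'b set)" "C \<noteq> {}"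
  shows "\<exists>F :: 'b \<Rightarrow> 'a. range F = C"
proof -
  from assms(1) obtain f :: "'b \<Rightarrow> 'a" where f: "C \<subseteq> range f"
    unfolding lepoll_iff by blast
  from assms(2) obtain c where c: "c \<in> C" by blast
  have "range (\<lambda>i. if f i \<in> C then f i else c) = C"
  proof
    show "C \<subseteq> range (\<lambda>i. if f i \<in> C then f i else c)"
    proof
      fix y assume "y \<in> C"
      moreover from this obtain i where "y = f i" using f by blast
      ultimately show "y \<in> range (\<lambda>i. if f i \<in> C then f i else c)"
        by (intro image_eqI[of _ _ i]) auto
    qed
  qed (use c in auto)
  then show ?thesis by blast
qed

text \<open>Each stage \<open>i\<close> contributes the whole \<open>G i\<close>-orbit of one new
  point to a single member of the family. Freshness of the points gives disjointness, and recurrence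
  of the targets gives thickness.\<close>

lemma almost_invariant_family:
  fixes \<K> :: "'a set set" and \<Phi> :: "('a \<Rightarrow> 'a) set"
  assumes \<K>: "\<K> \<lesssim> (UNIV :: nat set set)" "\<K> \<noteq> {}" "\<And>K. K \<in> \<K> \<Longrightarrow> \<not> small K"
    and \<Phi>: "\<Phi> \<lesssim> (UNIV :: nat set set)" "\<Phi> \<noteq> {}" "\<And>\<phi>. \<phi> \<in> \<Phi> \<Longrightarrow> bij \<phi>" "\<And>\<phi>. \<phi> \<in> \<Phi> \<Longrightarrow> inv \<phi> \<in> \<Phi>"
  obtains A :: "nat \<Rightarrow> 'a set"
  where "disjoint_family A" "\<And>n K. K \<in> \<K> \<Longrightarrow> \<not> small (A n \<inter> K)"
    "\<And>n \<phi>. \<phi> \<in> \<Phi> \<Longrightarrow> small (A n - \<phi> ` A n)"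
proof -
  obtain R :: "(nat set \<times> nat set) set" where wf: "wf R" and "trans R"
    and tot: "\<And>a b. a \<noteq> b \<Longrightarrow> (a, b) \<in> R \<or> (b, a) \<in> R"
    and small: "\<And>a. small {b. (b, a) \<in> R}"
    by (rule small_wellorder) blast
  obtain F :: "nat set \<Rightarrow> 'a set" where F: "range F = \<K>" using lepoll_imp_range[OF \<K>(1,2)] by blast
  obtain g :: "nat set \<Rightarrow> 'a \<Rightarrow> 'a" where g: "range g = \<Phi>" using lepoll_imp_range[OF \<Phi>(1,2)] by blast
  define le where "le i = insert i {b. (b, i) \<in> R}" for i
  \<comment> \<open>The maps listed up to stage \<open>i\<close>, with their inverses: a small set
    that grows with \<open>i\<close>.\<close>
  define G where "G i = g ` le i \<union> inv ` g ` le i" for i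
  have small_le: "small (le i)" for i
    using small_Un[OF countable_imp_small[of "{i}"] small[of i]] by (simp add: le_def)
  then have small_G: "small (G i)" for i
    unfolding G_def by (intro small_Un small_image)
  have G\<Phi>: "G i \<subseteq> \<Phi>" for i using g \<Phi>(4) unfolding G_def by blast
  have G_inv: "inv h \<in> G i" if "h \<in> G i" for h i
  proof -
    have "inv (inv (g j)) = g j" for j
      using \<Phi>(3) g by (intro inv_inv_eq) auto
    then show ?thesis using that by (auto simp: G_def)
  qed
  have le_mono: "le j \<subseteq> le i" if "(j, i) \<in> R" for i j
    using that \<open>trans R\<close> by (auto simp: le_def dest: transD)
  have G_mono: "G j \<subseteq> G i" if "(j, i) \<in> R" for i j
    unfolding G_def using le_mono[OF that] by (intro Un_mono image_mono)
  have orb_sym: "x \<in> orbit (G i) {y}" if "y \<in> orbit (G i) {x}" for x y i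
    using subsetD[OF G\<Phi>] \<Phi>(3) by (intro orbit_sym[OF _ G_inv that]) blast+

  text \<open>Slice \<open>0\<close> of an index names a member of \<open>\<K>\<close> and slice \<open>1\<close> the number of a family member;
    the remaining slices are free, so every such pair recurs continuum often.\<close>
  define K where "K i = F (slice i 0)" for i
  \<comment> \<open>A point outside the orbits of all earlier choices exists because those orbits
    form a small set, whereas the target \<open>K i\<close> is not small.\<close>
  have "\<exists>x. \<forall>i. x i \<in> K i - orbit (G i) (x ` {j. (j, i) \<in> R})"
  proof (rule dependent_wf_choice[OF wf, where P = "\<lambda>x i y. y \<in> K i - orbit (G i) (x ` {j. (j, i) \<in> R})"])
    fix f h :: "nat set \<Rightarrow> 'a" and i y assume "\<And>z. (z, i) \<in> R \<Longrightarrow> f z = h z"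
    then have "f ` {j. (j, i) \<in> R} = h ` {j. (j, i) \<in> R}" by force
    then show "(y \<in> K i - orbit (G i) (f ` {j. (j, i) \<in> R})) = (y \<in> K i - orbit (G i) (h ` {j. (j, i) \<in> R}))"
      by simp
  next
    fix i and f :: "nat set \<Rightarrow> 'a"
    have "small (orbit (G i) (f ` {j. (j, i) \<in> R}))"
      by (intro small_orbit small_G small_image small)
    moreover have "\<not> small (K i)" using \<K>(3) F unfolding K_def by blast
    ultimately show "\<exists>y. y \<in> K i - orbit (G i) (f ` {j. (j, i) \<in> R})"
      using small_subset by blast
  qed
  then obtain x where xK: "\<And>i. x i \<in> K i" and new: "\<And>i. x i \<notin> orbit (G i) (x ` {j. (j, i) \<in> R})"
    by blast
  \<comment> \<open>A common point \<open>z\<close> would put \<open>x i\<close> into the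
    \<open>G i\<close>-orbit of the earlier \<open>x j\<close>, since \<open>G j\<close> lies in
    \<open>G i\<close> and orbits can be traversed backwards.\<close>
  have disj1: False if "(j, i) \<in> R" "z \<in> orbit (G i) {x i}" "z \<in> orbit (G j) {x j}" for i j z
  proof -
    have "z \<in> orbit (G i) {x j}"
      using that(3) orbit_mono[OF G_mono[OF that(1)] order_refl] by blast
    then have "orbit (G i) {z} \<subseteq> orbit (G i) {x j}"
      by (intro orbit_trans) simp
    moreover have "x i \<in> orbit (G i) {z}"
      using that(2) by (rule orb_sym)
    moreover have "orbit (G i) {x j} \<subseteq> orbit (G i) (x ` {j. (j, i) \<in> R})"
      using that(1) by (intro orbit_mono) auto
    ultimately show False using new by blast
  qed
  have disj: "i = j" if "z \<in> orbit (G i) {x i}" "z \<in> orbit (G j) {x j}" for i j z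
    using disj1[of j i z] disj1[of i j z] that tot[of i j] by blast
  have x_inj: "inj x"
  proof (rule injI)
    fix i j assume "x i = x j"
    with orbit_superset[of "{x i}" "G i"] orbit_superset[of "{x j}" "G j"]
    show "i = j" by (intro disj[of "x i"]) auto
  qed

  define I where "I n = {i. slice i 1 = {n}}" for n
  define A where "A n = (\<Union>i\<in>I n. orbit (G i) {x i})" for n
  \<comment> \<open>If \<phi> moves a point of the stage \<open>i\<close> orbit out of
    \<open>A n\<close>, then \<phi> is not in \<open>G i\<close>, so \<open>i\<close> precedes the
    stage \<open>c\<close> that lists \<phi>. All such points lie in one small orbit.\<close>
  have diff: "small (\<phi> ` A n - A n)" if "\<phi> \<in> \<Phi>" for \<phi> n
  proof -
    obtain c where c: "g c = \<phi>" using g \<open>\<phi> \<in> \<Phi>\<close> by blast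
    have "small (\<phi> ` orbit (G c) (x ` le c))"
      by (intro small_image small_orbit small_G small_le)
    moreover have "\<phi> ` A n - A n \<subseteq> \<phi> ` orbit (G c) (x ` le c)"
    proof clarify
      fix z assume "z \<in> A n" "\<phi> z \<notin> A n"
      then obtain i where i: "i \<in> I n" "z \<in> orbit (G i) {x i}" "\<phi> z \<notin> orbit (G i) {x i}"
        unfolding A_def by blast
      then have "\<phi> \<notin> G i" using orbit_closed by metis
      then have "c \<notin> le i" using c unfolding G_def by blast
      then have "(i, c) \<in> R" using tot[of i c] by (auto simp: le_def)
      then have "orbit (G i) {x i} \<subseteq> orbit (G c) (x ` le c)"
        by (intro orbit_mono G_mono) (auto simp: le_def)
      with i(2) show "\<phi> z \<in> \<phi> ` orbit (G c) (x ` le c)" by blast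
    qed
    ultimately show ?thesis by (rule small_subset)
  qed
  have "I m \<inter> I n = {}" if "m \<noteq> n" for m n using that by (auto simp: I_def)
  then have "disjoint_family A"
    unfolding disjoint_family_on_def A_def using disj by blast
  moreover have "\<not> small (A n \<inter> L)" if "L \<in> \<K>" for n L
  proof -
    obtain i0 where i0: "F i0 = L" using F \<open>L \<in> \<K>\<close> by blast
    \<comment> \<open>\<open>e Y\<close> names the target \<open>L\<close> and the member
      \<open>n\<close>, and stores \<open>Y\<close> in all other slices. Letting \<open>Y\<close>
      vary yields continuum many points of \<open>A n\<close> in \<open>L\<close>.\<close>
    have "\<forall>Y. \<exists>i. (\<lambda>k. if k = 0 then i0 else if k = 1 then {n} else Y) = slice i"
      using surjD[OF surj_slice] by blast
    from choice[OF this] obtain e where e: "\<And>Y. slice (e Y) = (\<lambda>k. if k = 0 then i0 else if k = 1 then {n} else Y)"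
      by metis
    have "inj e"
    proof (rule injI)
      fix Y Z assume "e Y = e Z"
      then have "slice (e Y) 2 = slice (e Z) 2" by simp
      then show "Y = Z" by (simp add: e)
    qed
    then have "inj (x \<circ> e)" using x_inj by (simp add: inj_compose)
    moreover have "x (e Y) \<in> A n \<inter> L" for Y
    proof -
      have "e Y \<in> I n" "K (e Y) = L" by (simp_all add: I_def K_def e i0)
      then show ?thesis using xK[of "e Y"] orbit_superset[of "{x (e Y)}"] by (auto simp: A_def)
    qed
    ultimately show ?thesis
      unfolding small_def lepoll_def by (metis comp_apply image_subsetI)
  qed
  \<comment> \<open>The reverse difference is the image under \<phi> of the difference already
    treated, taken for \<open>inv \<phi>\<close>.\<close>
  moreover have "small (A n - \<phi> ` A n)" if "\<phi> \<in> \<Phi>" for \<phi> n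
  proof -
    have "small (\<phi> ` (inv \<phi> ` A n - A n))"
      using that \<Phi>(4) by (intro small_image diff)
    moreover have "A n - \<phi> ` A n \<subseteq> \<phi> ` (inv \<phi> ` A n - A n)"
    proof
      fix z assume z: "z \<in> A n - \<phi> ` A n"
      moreover have "z = \<phi> (inv \<phi> z)" using \<Phi>(3)[OF that] by (simp add: bij_is_surj surj_f_inv_f)
      ultimately show "z \<in> \<phi> ` (inv \<phi> ` A n - A n)" by blast
    qed
    ultimately show ?thesis by (rule small_subset)
  qed
  ultimately show thesis by (rule that)
qed

section \<open>Isometries, closed sets and Lebesgue measure\<close>

text \<open>The complement of a closed set is a union of members of a countable base, so a set of
  base indices codes it.\<close>

lemma closed_sets_lepoll_nat_sets:
  "{K :: 'a :: second_countable_topology set. closed K} \<lesssim> (UNIV :: nat set set)"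
proof -
  obtain \<B> :: "'a set set" where \<B>: "countable \<B>" "topological_basis \<B>"
    using ex_countable_basis by blast
  \<comment> \<open>The empty set is added so that the enumerated family is nonempty; it does not
    affect unions.\<close>
  define b where "b = from_nat_into (insert {} \<B>)"
  have b: "range b = insert {} \<B>"
    unfolding b_def using \<B>(1) by (intro range_from_nat_into) auto
  have "K \<in> range (\<lambda>N. - \<Union> (b ` N))" if "closed K" for K
  proof -
    obtain \<U> where "\<U> \<subseteq> \<B>" "\<Union> \<U> = - K"
      using \<B>(2) \<open>closed K\<close> unfolding topological_basis_def by (metis open_Compl)
    moreover from this b have "b ` (b -` \<U>) = \<U>"
      by (intro image_vimage_eq[THEN trans]) blast
    ultimately have "K = - \<Union> (b ` (b -` \<U>))" by simp
    then show ?thesis by blast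
  qed
  then show ?thesis
    unfolding lepoll_iff by blast
qed

lemma isometry_inv:
  assumes "\<phi> \<in> isometries"
  shows "inv \<phi> \<in> isometries"
proof -
  have "bij \<phi>" and d: "\<And>x y. dist (\<phi> x) (\<phi> y) = dist x y"
    using assms by (auto simp: isometries_def)
  then have "dist (inv \<phi> x) (inv \<phi> y) = dist x y" for x y
    using d[of "inv \<phi> x" "inv \<phi> y"] by (simp add: bij_is_surj surj_f_inv_f)
  with \<open>bij \<phi>\<close> show ?thesis
    by (simp add: isometries_def bij_imp_bij_inv)
qed

lemma isometry_continuous:
  assumes "\<phi> \<in> isometries"
  shows "continuous_on S \<phi>"
  using assms unfolding continuous_on_iff isometries_def by auto

text \<open>An isometry is determined by its graph, a closed subset of the product.\<close>

lemma isometries_lepoll_nat_sets: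
  "(isometries :: ('a :: {metric_space, second_countable_topology} \<Rightarrow> 'a) set) \<lesssim> (UNIV :: nat set set)"
proof (rule lepoll_trans[OF _ closed_sets_lepoll_nat_sets])
  let ?graph = "\<lambda>\<phi> :: 'a \<Rightarrow> 'a. {z. snd z = \<phi> (fst z)}"
  have "inj ?graph"
    by (rule injI) (force simp: set_eq_iff fun_eq_iff)
  moreover have "closed (?graph \<phi>)" if "\<phi> \<in> isometries" for \<phi>
    using that
    by (intro closed_Collect_eq continuous_intros continuous_on_compose2[OF isometry_continuous[of \<phi> UNIV]]) auto
  ultimately show "(isometries :: ('a \<Rightarrow> 'a) set) \<lesssim> {K :: ('a \<times> 'a) set. closed K}"
    unfolding lepoll_def by (intro exI[of _ ?graph]) (auto intro: inj_on_subset)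
qed

lemma isometry_image_ball:
  assumes "\<phi> \<in> isometries"
  shows "\<phi> ` ball x r = ball (\<phi> x) r"
proof -
  have d: "\<And>x y. dist (\<phi> x) (\<phi> y) = dist x y" and s: "surj \<phi>"
    using assms by (auto simp: isometries_def bij_is_surj)
  have "y \<in> \<phi> ` ball x r" if "dist (\<phi> x) y < r" for y
  proof -
    obtain z where "y = \<phi> z" using s by (rule surjE)
    then show ?thesis using that d by auto
  qed
  then show ?thesis using d by auto
qed

lemma isometry_image_negligible:
  fixes \<phi> :: "'a :: euclidean_space \<Rightarrow> 'a"
  assumes "\<phi> \<in> isometries" "negligible N"
  shows "negligible (\<phi> ` N)"
proof (rule negligible_locally_Lipschitz_image[OF _ assms(2)])
  have "norm (\<phi> y - \<phi> x) \<le> 1 * norm (y - x)" for x y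
    using assms(1) by (simp add: isometries_def flip: dist_norm)
  then show "\<exists>T B. open T \<and> x \<in> T \<and> (\<forall>y \<in> N \<inter> T. norm (\<phi> y - \<phi> x) \<le> B * norm (y - x))" for x
    using open_UNIV by blast
qed simp

text \<open>The change of variables theorems of the library need a wellordered index type; Vitali's
  covering theorem reduces isometry invariance to balls, whose volume depends only on the radius.\<close>

lemma isometry_emeasure_open:
  fixes \<phi> :: "'a :: euclidean_space \<Rightarrow> 'a"
  assumes \<phi>: "\<phi> \<in> isometries" and U: "open U"
  shows "emeasure lebesgue (\<phi> ` U) = emeasure lebesgue U"
proof -
  \<comment> \<open>All balls inside \<open>U\<close>, indexed by centre and radius: they form a
    Vitali cover because arbitrarily small radii occur at each point.\<close>
  define K where "K = {(x :: 'a, r :: real). 0 < r \<and> ball x r \<subseteq> U}"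
  have inj: "inj \<phi>" using \<phi> by (simp add: isometries_def bij_is_inj)
  have cov: "\<exists>i. i \<in> K \<and> x \<in> ball (fst i) (snd i) \<and> snd i < d" if "x \<in> U" "0 < d" for x d
  proof -
    obtain e where "0 < e" "ball x e \<subseteq> U" using U \<open>x \<in> U\<close> by (meson openE)
    moreover have "ball x (min e (d / 2)) \<subseteq> ball x e" by (intro subset_ball) simp
    ultimately show ?thesis using \<open>0 < d\<close>
      by (intro exI[of _ "(x, min e (d / 2))"]) (auto simp: K_def)
  qed
  obtain C where C: "countable C" "C \<subseteq> K"
     "pairwise (\<lambda>i j. disjnt (ball (fst i) (snd i)) (ball (fst j) (snd j))) C"
     "negligible (U - (\<Union>i\<in>C. ball (fst i) (snd i)))"
    using Vitali_covering_theorem_balls[of U K fst snd, OF cov] by blast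
  define B where "B i = ball (fst i) (snd i)" for i :: "'a \<times> real"
  define N where "N = U - (\<Union>i\<in>C. B i)"
  have "B i \<subseteq> U" "0 < snd i" if "i \<in> C" for i
    using subsetD[OF C(2) that] by (auto simp: K_def B_def)
  then have U_eq: "U = (\<Union>i\<in>C. B i) \<union> N" and pos: "\<And>i. i \<in> C \<Longrightarrow> 0 < snd i"
    unfolding N_def by blast+
  have N: "N \<in> null_sets lebesgue" "\<phi> ` N \<in> null_sets lebesgue"
    using C(4) isometry_image_negligible[OF \<phi>] by (simp_all add: N_def B_def negligible_iff_null_sets)
  have disj: "disjoint_family_on B C"
    using C(3) by (auto simp: pairwise_def disjoint_family_on_def disjnt_def B_def)
  have sets: "B i \<in> sets lebesgue" "\<phi> ` B i \<in> sets lebesgue" for i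
    using isometry_image_ball[OF \<phi>] by (simp_all add: B_def)
  have "emeasure lebesgue (\<phi> ` B i) = emeasure lebesgue (B i)" if "i \<in> C" for i
    using pos[OF that] by (simp add: B_def isometry_image_ball[OF \<phi>] emeasure_ball)
  then have "(\<integral>\<^sup>+i. emeasure lebesgue (\<phi> ` B i) \<partial>count_space C) = (\<integral>\<^sup>+i. emeasure lebesgue (B i) \<partial>count_space C)"
    by (intro nn_integral_cong) simp
  moreover have "disjoint_family_on (\<lambda>i. \<phi> ` B i) C"
    using disj inj unfolding disjoint_family_on_def by (metis image_Int image_empty)
  ultimately have UN_eq: "emeasure lebesgue (\<Union>i\<in>C. \<phi> ` B i) = emeasure lebesgue (\<Union>i\<in>C. B i)"
    using disj sets C(1) by (simp add: emeasure_UN_countable)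
  have UN: "(\<Union>i\<in>C. B i) \<in> sets lebesgue" "(\<Union>i\<in>C. \<phi> ` B i) \<in> sets lebesgue"
    using sets C(1) by auto
  have \<phi>U_eq: "\<phi> ` U = (\<Union>i\<in>C. \<phi> ` B i) \<union> \<phi> ` N"
    by (subst U_eq) auto
  have "emeasure lebesgue (\<phi> ` U) = emeasure lebesgue (\<Union>i\<in>C. \<phi> ` B i)"
    unfolding \<phi>U_eq using UN(2) N(2) by (rule emeasure_Un_null_set)
  moreover have "emeasure lebesgue U = emeasure lebesgue (\<Union>i\<in>C. B i)"
    by (subst U_eq) (rule emeasure_Un_null_set[OF UN(1) N(1)])
  ultimately show ?thesis using UN_eq by simp
qed

lemma isometry_image_borel:
  assumes "\<phi> \<in> isometries" "B \<in> sets borel"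
  shows "\<phi> ` B \<in> sets borel"
proof -
  have "inv \<phi> \<in> borel_measurable borel"
    using isometry_continuous[OF isometry_inv[OF assms(1)]] by (rule borel_measurable_continuous_onI)
  then have "inv \<phi> -` B \<inter> space borel \<in> sets borel"
    using assms(2) by (rule measurable_sets)
  moreover have "inv \<phi> -` B = \<phi> ` B"
    using assms(1) by (auto simp: isometries_def bij_vimage_eq_inv_image inv_inv_eq bij_imp_bij_inv)
  ultimately show ?thesis by simp
qed

text \<open>Lebesgue measure is determined by its values on boxes. These agree for its pushforward
  under \<open>inv \<phi>\<close> by the case of open sets.\<close>

lemma isometry_emeasure_lborel:
  fixes \<phi> :: "'a :: euclidean_space \<Rightarrow> 'a"
  assumes \<phi>: "\<phi> \<in> isometries" and B: "B \<in> sets borel"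
  shows "emeasure lborel (\<phi> ` B) = emeasure lborel B"
proof -
  have bij: "bij \<phi>" using \<phi> by (simp add: isometries_def)
  have m: "inv \<phi> \<in> borel_measurable borel"
    using isometry_continuous[OF isometry_inv[OF \<phi>]] by (rule borel_measurable_continuous_onI)
  have v: "inv \<phi> -` S = \<phi> ` S" for S
    using bij by (auto simp: bij_vimage_eq_inv_image inv_inv_eq bij_imp_bij_inv)
  have "lborel = distr lborel borel (inv \<phi>)"
  proof (rule lborel_eqI)
    fix l u :: 'a assume lu: "\<And>b. b \<in> Basis \<Longrightarrow> l \<bullet> b \<le> u \<bullet> b"
    have "emeasure (distr lborel borel (inv \<phi>)) (box l u) = emeasure lborel (\<phi> ` box l u)"
      using m by (simp add: emeasure_distr v)
    also have "\<dots> = emeasure lborel (box l u)"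
      using isometry_emeasure_open[OF \<phi> open_box, of l u] isometry_image_borel[OF \<phi>, of "box l u"] by simp
    finally show "emeasure (distr lborel borel (inv \<phi>)) (box l u) = (\<Prod>b\<in>Basis. (u - l) \<bullet> b)"
      using lu by simp
  qed simp
  then have "emeasure lborel B = emeasure (distr lborel borel (inv \<phi>)) B" by simp
  also have "\<dots> = emeasure lborel (\<phi> ` B)"
    using m B by (simp add: emeasure_distr v)
  finally show ?thesis by simp
qed

section \<open>Closed sets of positive Lebesgue measure\<close>

lemma borel_inner_closed_pos:
  fixes B :: "'a :: euclidean_space set"
  assumes B: "B \<in> sets borel" and pos: "0 < emeasure lborel B"
  obtains K where "closed K" "K \<subseteq> B" "0 < emeasure lborel K"
proof -
  \<comment> \<open>A finite positive lower bound for the measure of \<open>B\<close>, chosen as 1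
    if that measure is infinite; removing less than \<open>e\<close> leaves positive
    measure.\<close>
  obtain e :: real where e: "0 < e" "ennreal e \<le> emeasure lborel B"
  proof (cases "emeasure lborel B")
    case (real r)
    with pos show thesis by (intro that[of r]) auto
  next
    case top
    then show thesis by (intro that[of 1]) auto
  qed
  obtain K where K: "closed K" "K \<subseteq> B" "emeasure lebesgue (B - K) < ennreal e"
    using sets_lebesgue_inner_closed[OF _ e(1), of B] B by (metis sets_completionI_sets sets_lborel)
  have "emeasure lborel (B - K) < emeasure lborel B"
    using K B e(2) by (simp add: order_less_le_trans)
  moreover have "emeasure lborel B = emeasure lborel K + emeasure lborel (B - K)"
    using K B plus_emeasure[of K lborel "B - K"] by (simp add: Un_absorb1)
  ultimately have "0 < emeasure lborel K"
    by (cases "emeasure lborel K = 0") (auto simp: zero_less_iff_neq_zero)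
  with K that show thesis by blast
qed

text \<open>Removing from \<open>K\<close> all basic open sets in which it is null leaves a nonempty perfect set.\<close>

lemma closed_pos_not_small:
  fixes K :: "'a :: euclidean_space set"
  assumes K: "closed K" and pos: "0 < emeasure lborel K"
  shows "\<not> small K"
proof -
  obtain \<B> :: "'a set set" where \<B>: "countable \<B>" "topological_basis \<B>"
    using ex_countable_basis by blast
  define \<N> where "\<N> = {U \<in> \<B>. emeasure lborel (K \<inter> U) = 0}"
  define P where "P = K - \<Union>\<N>"
  have op: "open U" if "U \<in> \<B>" for U using \<B>(2) that by (rule topological_basis_open)
  have "closed P"
    unfolding P_def using K op by (intro closed_Diff open_Union) (auto simp: \<N>_def)
  have "countable \<N>" using \<B>(1) unfolding \<N>_def by (rule countable_subset[rotated]) auto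
  then have UN: "(\<Union>U\<in>\<N>. K \<inter> U) \<in> null_sets lborel"
    using K op by (intro null_sets_UN') (auto simp: \<N>_def null_sets_def)
  have null: "K - P \<in> null_sets lborel"
  proof -
    have "K - P = (\<Union>U\<in>\<N>. K \<inter> U)" by (auto simp: P_def)
    then show ?thesis using UN by (simp only:)
  qed
  have eq: "emeasure lborel (K \<inter> V) = emeasure lborel (P \<inter> V)" if "open V" for V
  proof -
    have "emeasure lborel ((P \<inter> V) \<union> (K - P) \<inter> V) = emeasure lborel (P \<inter> V)"
      using null that \<open>closed P\<close> by (intro emeasure_Un_null_set null_set_Int2) auto
    moreover have "(P \<inter> V) \<union> (K - P) \<inter> V = K \<inter> V" by (auto simp: P_def)
    ultimately show ?thesis by simp
  qed
  have "P \<noteq> {}" using eq[of UNIV] pos by auto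
  \<comment> \<open>An isolated point of \<open>P\<close> would have a basic neighbourhood meeting
    \<open>P\<close> in at most one point. That neighbourhood meets \<open>K\<close> in a null set
    and was therefore removed.\<close>
  have "x islimpt P" if "x \<in> P" for x
  proof (rule ccontr)
    assume "\<not> x islimpt P"
    then obtain V where V: "x \<in> V" "open V" "\<forall>y\<in>P. y \<in> V \<longrightarrow> y = x"
      unfolding islimpt_def by blast
    obtain U where U: "U \<in> \<B>" "x \<in> U" "U \<subseteq> V"
      using topological_basisE[OF \<B>(2) V(2,1)] by blast
    have "P \<inter> U \<subseteq> {x}" using V U by blast
    then have "countable (P \<inter> U)" by (rule countable_subset) simp
    then have "emeasure lborel (K \<inter> U) = 0"
      by (simp add: eq[OF op[OF U(1)]] emeasure_lborel_countable)
    with U(1) have "U \<in> \<N>" by (simp add: \<N>_def)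
    with U(2) \<open>x \<in> P\<close> show False unfolding P_def by blast
  qed
  moreover have "euclidean derived_set_of P = {x. x islimpt P}"
    by (auto simp: derived_set_of_def islimpt_def)
  ultimately have "euclidean derived_set_of P = P"
    using \<open>closed P\<close> by (auto simp: closed_limpt)
  then have "(UNIV :: real set) \<lesssim> P"
    using \<open>P \<noteq> {}\<close> by (rule lepoll_perfect_set[OF disjI1[OF completely_metrizable_space_euclidean]])
  then have "(UNIV :: nat set set) \<lesssim> P"
    using nat_sets_eqpoll_reals lepoll_trans1 by blast
  then have "(UNIV :: nat set set) \<lesssim> K"
    by (rule lepoll_trans) (auto simp: P_def intro: subset_imp_lepoll)
  then show ?thesis by (simp add: small_def)
qed

section \<open>Extending a measure along thick sets\<close>

text \<open>By \<open>thick\<close>, the trace of a measurable set on any one \<open>A n\<close>,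
  even up to a small error, determines its measure.\<close>

locale thick_family =
  fixes N :: "'a measure" and A :: "nat \<Rightarrow> 'a set"
  assumes space_N: "space N = UNIV"
    and thick: "\<And>n B. B \<in> sets N \<Longrightarrow> small (B \<inter> A n) \<Longrightarrow> emeasure N B = 0"
begin

definition version :: "nat \<Rightarrow> 'a set \<Rightarrow> 'a set \<Rightarrow> bool" where
  "version n E B \<longleftrightarrow> B \<in> sets N \<and> small (sym_diff E B \<inter> A n)"

definition extended_sets :: "'a set set" where
  "extended_sets = {E. \<forall>n. \<exists>B. version n E B}"

text \<open>The choice is immaterial by \<open>version_emeasure_le\<close>.\<close>

definition trace :: "nat \<Rightarrow> 'a set \<Rightarrow> ennreal" where
  "trace n E = emeasure N (SOME B. version n E B)"

text \<open>Writing the sum over \<open>n\<close> as an integral for counting measure reduces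
  countable additivity to interchanging a series with an integral.\<close>

definition sum_measure :: "'a measure" where
  "sum_measure = measure_of UNIV extended_sets (\<lambda>E. \<integral>\<^sup>+n. trace n E \<partial>count_space UNIV)"

lemma version_refl: "B \<in> sets N \<Longrightarrow> version n B B"
  by (simp add: version_def countable_imp_small)

text \<open>Two versions differ on \<open>A n\<close> by a small set only, so \<open>thick\<close>
  makes \<open>B - C\<close> null.\<close>

lemma version_emeasure_le:
  assumes "version n E B" "version n E C"
  shows "emeasure N B \<le> emeasure N C"
proof -
  have sets: "B \<in> sets N" "C \<in> sets N" using assms by (auto simp: version_def)
  have "small (sym_diff E B \<inter> A n \<union> sym_diff E C \<inter> A n)"
    using assms by (auto simp: version_def intro: small_Un)
  then have "small ((B - C) \<inter> A n)"
    by (rule small_subset) auto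
  then have "emeasure N (B - C) = 0"
    using sets by (intro thick) auto
  moreover have "emeasure N B \<le> emeasure N (C \<union> (B - C))"
    using sets by (intro emeasure_mono) auto
  moreover have "emeasure N (C \<union> (B - C)) \<le> emeasure N C + emeasure N (B - C)"
    using sets by (intro emeasure_subadditive) auto
  ultimately show ?thesis by simp
qed

lemma trace_eq:
  assumes "version n E B"
  shows "trace n E = emeasure N B"
proof -
  have "version n E (SOME B. version n E B)" using assms by (rule someI)
  with assms show ?thesis
    unfolding trace_def by (intro antisym version_emeasure_le)
qed

lemma version_Compl:
  assumes "version n E B"
  shows "version n (- E) (- B)"
proof -
  have "- B \<in> sets N" using assms sets.compl_sets[of B N]
    by (simp add: version_def space_N Compl_eq_Diff_UNIV)
  moreover have "sym_diff (- E) (- B) = sym_diff E B" by auto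
  ultimately show ?thesis using assms by (simp add: version_def)
qed

lemma version_UN:
  fixes E B :: "nat \<Rightarrow> 'a set"
  assumes "\<And>k. version n (E k) (B k)"
  shows "version n (\<Union>k. E k) (\<Union>k. B k)"
proof -
  have "small (\<Union>k. sym_diff (E k) (B k) \<inter> A n)"
    using assms by (intro small_UN_nat) (simp add: version_def)
  then have "small (sym_diff (\<Union>k. E k) (\<Union>k. B k) \<inter> A n)"
    by (rule small_subset) blast
  then show ?thesis using assms by (auto simp: version_def)
qed

text \<open>Versions of disjoint sets may overlap. A point of \<open>E k\<close> lost to an earlier
  \<open>B j\<close> lies outside \<open>E j\<close>, hence in the error set of index
  \<open>j\<close>; on \<open>A n\<close> these error sets have a small union.\<close>

lemma version_disjointed:
  fixes E B :: "nat \<Rightarrow> 'a set"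
  assumes B: "\<And>k. version n (E k) (B k)" and E: "disjoint_family E"
  shows "version n (E k) (disjointed B k)"
proof -
  have "small (\<Union>k. sym_diff (E k) (B k) \<inter> A n)"
    using B by (intro small_UN_nat) (simp add: version_def)
  then have "small (sym_diff (E k) (disjointed B k) \<inter> A n)"
  proof (rule small_subset)
    show "sym_diff (E k) (disjointed B k) \<inter> A n \<subseteq> (\<Union>k. sym_diff (E k) (B k) \<inter> A n)"
    proof
      fix x assume x: "x \<in> sym_diff (E k) (disjointed B k) \<inter> A n"
      then consider "x \<in> sym_diff (E k) (B k)" | j where "x \<in> E k" "j < k" "x \<in> B j"
        by (auto simp: disjointed_def)
      then show "x \<in> (\<Union>k. sym_diff (E k) (B k) \<inter> A n)"
      proof cases
        case (2 j)
        then have "x \<notin> E j"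
          using disjoint_family_onD[OF E UNIV_I UNIV_I, of k j] by auto
        with 2 x show ?thesis by blast
      qed (use x in blast)
    qed
  qed
  moreover have "disjointed B k \<in> sets N"
    using B sets.range_disjointed_sets[of B N] by (auto simp: version_def)
  ultimately show ?thesis by (simp add: version_def)
qed

lemma sigma_algebra_extended_sets: "sigma_algebra UNIV extended_sets"
  unfolding sigma_algebra_iff2
proof (intro conjI ballI allI impI)
  show "{} \<in> extended_sets"
    using version_refl[of "{}"] by (auto simp: extended_sets_def)
  fix E assume "E \<in> extended_sets"
  then show "UNIV - E \<in> extended_sets"
    using version_Compl unfolding extended_sets_def Compl_eq_Diff_UNIV[symmetric] by blast
next
  fix E :: "nat \<Rightarrow> 'a set" assume E: "range E \<subseteq> extended_sets"
  have "\<exists>B. version n (\<Union>k. E k) B" for n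
  proof -
    have "\<forall>k. \<exists>B. version n (E k) B" using E by (auto simp: extended_sets_def)
    from choice[OF this] show ?thesis using version_UN by blast
  qed
  then show "(\<Union>k. E k) \<in> extended_sets" by (simp add: extended_sets_def)
qed simp

lemma suminf_trace:
  assumes E: "range E \<subseteq> extended_sets" "disjoint_family E"
  shows "(\<Sum>k. trace n (E k)) = trace n (\<Union>k. E k)"
proof -
  have "\<forall>k. \<exists>B. version n (E k) B" using E(1) by (auto simp: extended_sets_def)
  from choice[OF this] obtain B where "\<And>k. version n (E k) (B k)" by blast
  then have v: "\<And>k. version n (E k) (disjointed B k)"
    using E(2) by (intro version_disjointed)
  have "(\<Sum>k. emeasure N (disjointed B k)) = emeasure N (\<Union>k. disjointed B k)"
    using v by (intro suminf_emeasure disjoint_family_disjointed) (auto simp: version_def)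
  then show ?thesis
    using trace_eq[OF v] trace_eq[OF version_UN[OF v]] by simp
qed

section \<open>Values and sigma-finiteness of the sum measure\<close>

lemma space_sum_measure: "space sum_measure = UNIV"
  by (simp add: sum_measure_def space_measure_of_conv)

lemma sets_sum_measure: "sets sum_measure = extended_sets"
  unfolding sum_measure_def
  using sigma_algebra.sets_measure_of_eq[OF sigma_algebra_extended_sets] .

lemma emeasure_sum_measure:
  assumes "E \<in> extended_sets"
  shows "emeasure sum_measure E = (\<integral>\<^sup>+n. trace n E \<partial>count_space UNIV)"
proof -
  let ?\<mu> = "\<lambda>E. \<integral>\<^sup>+n. trace n E \<partial>count_space UNIV"
  have "positive extended_sets ?\<mu>"
    by (simp add: positive_def trace_eq[OF version_refl[of "{}"]])
  moreover have "countably_additive extended_sets ?\<mu>"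
    unfolding countably_additive_def by (simp add: suminf_trace flip: nn_integral_suminf)
  ultimately show ?thesis
    using emeasure_measure_of_sigma[OF sigma_algebra_extended_sets _ _ assms, of ?\<mu>]
    by (simp add: sum_measure_def)
qed

lemma sets_subset_sum_measure: "sets N \<subseteq> sets sum_measure"
  using version_refl by (auto simp: sets_sum_measure extended_sets_def)

text \<open>\<open>B\<close> is its own version for every \<open>n\<close>, so the sum has
  infinitely many equal terms.\<close>

lemma emeasure_sum_measure_sets:
  assumes "B \<in> sets N"
  shows "emeasure sum_measure B = \<infinity> * emeasure N B"
  using sets_subset_sum_measure assms
  by (auto simp: emeasure_sum_measure trace_eq[OF version_refl] sets_sum_measure mult.commute)

text \<open>By disjointness \<open>A n \<inter> B\<close> leaves no trace on any other
  \<open>A m\<close>, where the empty set is a version.\<close>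

lemma version_Int:
  assumes "disjoint_family A" "B \<in> sets N"
  shows "version m (A n \<inter> B) (if m = n then B else {})"
proof -
  have "sym_diff (A n \<inter> B) (if m = n then B else {}) \<inter> A m = {}"
    using assms(1) by (auto simp: disjoint_family_on_def)
  then show ?thesis using assms(2) by (simp add: version_def countable_imp_small)
qed

lemma emeasure_sum_measure_Int:
  assumes "disjoint_family A" "B \<in> sets N"
  shows "emeasure sum_measure (A n \<inter> B) = emeasure N B"
proof -
  have v: "version m (A n \<inter> B) (if m = n then B else {})" for m
    using assms by (rule version_Int)
  then have "A n \<inter> B \<in> extended_sets" by (auto simp: extended_sets_def)
  then have "emeasure sum_measure (A n \<inter> B) = (\<integral>\<^sup>+m. emeasure N (if m = n then B else {}) \<partial>count_space UNIV)"
    using trace_eq[OF v] by (simp add: emeasure_sum_measure)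
  also have "\<dots> = (\<Sum>m\<in>{n}. emeasure N (if m = n then B else {}))"
    by (rule nn_integral_count_space') auto
  finally show ?thesis by simp
qed

text \<open>The sets \<open>A n \<inter> F k\<close> have finite measure. What lies outside all
  \<open>A n\<close> has the empty version for every index and so measure 0.\<close>

lemma sigma_finite_sum_measure:
  assumes "sigma_finite_measure N" and A: "disjoint_family A"
  shows "sigma_finite_measure sum_measure"
proof -
  obtain F :: "nat \<Rightarrow> 'a set" where F: "range F \<subseteq> sets N" "(\<Union>k. F k) = space N" "\<And>k. emeasure N (F k) \<noteq> \<infinity>"
    using sigma_finite_measure.sigma_finite[OF assms(1)] by metis
  have v: "version m (A n \<inter> F k) (if m = n then F k else {})" for m n k
    using A F(1) by (intro version_Int) auto
  have rest: "version m (- (\<Union>n. A n)) {}" for m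
  proof -
    have "sym_diff (- (\<Union>n. A n)) {} \<inter> A m = {}" by auto
    then show ?thesis by (simp add: version_def countable_imp_small)
  qed
  define \<C> where "\<C> = insert (- (\<Union>n. A n)) (range (\<lambda>(n, k). A n \<inter> F k))"
  have sets: "\<C> \<subseteq> extended_sets"
  proof -
    have "A n \<inter> F k \<in> extended_sets" for n k
      using v[of _ n k] unfolding extended_sets_def by blast
    moreover have "- (\<Union>n. A n) \<in> extended_sets"
      using rest unfolding extended_sets_def by blast
    ultimately show ?thesis unfolding \<C>_def by auto
  qed
  moreover have "\<Union>\<C> = UNIV"
    using F(2) by (fastforce simp: \<C>_def space_N)
  moreover have "emeasure sum_measure (A n \<inter> F k) \<noteq> \<infinity>" for n k
    using F(1) F(3)[of k] A by (subst emeasure_sum_measure_Int) auto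
  moreover have "emeasure sum_measure (- (\<Union>n. A n)) = 0"
    using sets trace_eq[OF rest] by (simp add: \<C>_def emeasure_sum_measure del: Compl_UN)
  moreover have "countable \<C>" by (simp add: \<C>_def)
  ultimately show ?thesis
    by (intro sigma_finite_measure.intro exI[of _ \<C>])
       (auto simp: \<C>_def space_sum_measure sets_sum_measure)
qed

end

section \<open>Application to Lebesgue measure and isometries\<close>

lemma exists_isometry_invariant_infinite_extension:
  "\<exists>M :: 'a :: euclidean_space measure.
    space M = UNIV \<and>
    isometry_invariant_sets (sets M) \<and>
    sets borel \<subseteq> sets M \<and>
    isometry_invariant_measure M \<and>
    sigma_finite_measure M \<and>
    (\<forall>B\<in>sets borel.
       (emeasure lebesgue B = 0 \<longrightarrow> emeasure M B = 0) \<and>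
       (emeasure lebesgue B > 0 \<longrightarrow> emeasure M B = \<infinity>))"
proof -
  define \<K> where "\<K> = {K :: 'a set. closed K \<and> 0 < emeasure lborel K}"
  have "\<K> \<lesssim> {K :: 'a set. closed K}"
    by (rule subset_imp_lepoll) (auto simp: \<K>_def)
  then have "\<K> \<lesssim> (UNIV :: nat set set)"
    using closed_sets_lepoll_nat_sets by (rule lepoll_trans)
  moreover have "UNIV \<in> \<K>" by (simp add: \<K>_def)
  moreover have "id \<in> isometries" by (simp add: isometries_def)
  moreover have "bij \<phi>" if "\<phi> \<in> isometries" for \<phi> :: "'a \<Rightarrow> 'a"
    using that by (simp add: isometries_def)
  moreover have "\<not> small K" if "K \<in> \<K>" for K
    using that closed_pos_not_small[of K] by (simp add: \<K>_def)
  ultimately obtain A :: "nat \<Rightarrow> 'a set" where disj: "disjoint_family A"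
    and thick: "\<And>n K. K \<in> \<K> \<Longrightarrow> \<not> small (A n \<inter> K)"
    and inv: "\<And>n \<phi>. \<phi> \<in> isometries \<Longrightarrow> small (A n - \<phi> ` A n)"
    using isometries_lepoll_nat_sets isometry_inv
    by (elim almost_invariant_family[where \<Phi> = isometries]) blast+
  interpret thick_family lborel A
  proof
    fix n and B :: "'a set" assume B: "B \<in> sets lborel" "small (B \<inter> A n)"
    show "emeasure lborel B = 0"
    proof (rule ccontr)
      assume "emeasure lborel B \<noteq> 0"
      then obtain K where "closed K" "K \<subseteq> B" "0 < emeasure lborel K"
        using B(1) borel_inner_closed_pos[of B] by (auto simp: zero_less_iff_neq_zero)
      then have "\<not> small (A n \<inter> K)" "A n \<inter> K \<subseteq> B \<inter> A n"
        by (auto intro!: thick simp: \<K>_def)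
      with B(2) show False using small_subset by blast
    qed
  qed simp
  have image: "version n (\<phi> ` E) (\<phi> ` B)" if "version n E B" "\<phi> \<in> isometries" for n E B \<phi>
  proof -
    have "inj \<phi>" using that(2) by (simp add: isometries_def bij_is_inj)
    have "small (\<phi> ` (sym_diff E B \<inter> A n) \<union> (A n - \<phi> ` A n))"
      using that by (intro small_Un small_image inv) (simp_all add: version_def)
    moreover have "sym_diff (\<phi> ` E) (\<phi> ` B) \<inter> A n \<subseteq> \<phi> ` (sym_diff E B \<inter> A n) \<union> (A n - \<phi> ` A n)"
      using \<open>inj \<phi>\<close> by (auto simp: inj_image_mem_iff inj_eq)
    ultimately have "small (sym_diff (\<phi> ` E) (\<phi> ` B) \<inter> A n)" by (rule small_subset)
    then show ?thesis
      using that isometry_image_borel[OF that(2)] by (simp add: version_def)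
  qed
  have sets: "\<phi> ` E \<in> extended_sets" if "E \<in> extended_sets" "\<phi> \<in> isometries" for E \<phi>
    using that image unfolding extended_sets_def by blast
  have "trace n (\<phi> ` E) = trace n E" if E: "E \<in> extended_sets" "\<phi> \<in> isometries" for n E \<phi>
  proof -
    obtain B where B: "version n E B" using E(1) by (auto simp: extended_sets_def)
    then have "emeasure lborel (\<phi> ` B) = emeasure lborel B"
      using E(2) by (intro isometry_emeasure_lborel) (simp_all add: version_def)
    then show ?thesis using trace_eq[OF B] trace_eq[OF image[OF B E(2)]] by simp
  qed
  with sets have "isometry_invariant_measure sum_measure" "isometry_invariant_sets (sets sum_measure)"
    by (simp_all add: isometry_invariant_measure_def isometry_invariant_sets_def sets_sum_measure emeasure_sum_measure)
  moreover have "sigma_finite_measure sum_measure"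
    using lborel.sigma_finite_measure_axioms disj by (rule sigma_finite_sum_measure)
  \<comment> \<open>On Borel sets the measure is infinity times Lebesgue measure, and infinity times
    0 is 0 in \<open>ennreal\<close>, which settles both cases.\<close>
  ultimately show ?thesis
    using sets_subset_sum_measure emeasure_sum_measure_sets space_sum_measure
    by (intro exI[of _ sum_measure]) (simp add: ennreal_top_mult)
qed

theorem theorem1p1:
  shows "\<exists>M :: (real ^ 'n::finite) measure.
    space M = UNIV \<and>
    isometry_invariant_sets (sets M) \<and>
    sets borel \<subseteq> sets M \<and>
    isometry_invariant_measure M \<and>
    sigma_finite_measure M \<and>
    (\<forall>B\<in>sets borel.
       (emeasure lebesgue B = 0 \<longrightarrow> emeasure M B = 0) \<and>
       (emeasure lebesgue B > 0 \<longrightarrow> emeasure M B = \<infinity>))"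
  by (rule exists_isometry_invariant_infinite_extension)

end
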